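(* Let $K$ be a finite weighted simplicial complex and $p\ge 1$. Let $W_{p-1}$ and $W_p$ be the diagonal weight matrices on the $(p-1)$- and $p$-simplices, respectively, and let $B_p$ be the matrix of the boundary operator $\partial_p$ in the standard bases (oriented simplices). With respect to the standard basis $\mathcal{B}_p$ of $C_p(K)$, the effective resistance bilinear form $\mathcal{R}_p$ has the matrix representation $$[\mathcal{R}_p]_{\mathcal{B}_p,\mathcal{B}_p} = B_p^\top W_{p-1}^{-1/2}\left(W_{p-1}^{-1/2} B_p W_p B_p^\top W_{p-1}^{-1/2}\right)^{+} W_{p-1}^{-1/2} B_p ,$$ which reduces to $B_p^\top (B_p W_p B_p^\top)^{+} B_p$ when the $(p-1)$-simplices have unit weights ($W_{p-1}=\mathrm{Id}$).
   Context: $K$ is a finite simplicial complex with a fixed ordering of its vertices (which orients all simplices). $K_p=\{\sigma_1,\dots,\sigma_{n_p}\}$ is the set of $p$-simplices, and each $K_p$ carries a weight function $w_p:K_p\to\mathbb{R}_{>0}$; $W_p=\mathrm{diag}(w_p(\sigma_1),\dots,w_p(\sigma_{n_p}))$. $C_p(K)$ is the real vector space with basis $\mathcal{B}_p=\{\sigma_1,\dots,\sigma_{n_p}\}$ (the standard basis), with the usual boundary maps $\partial_p:C_p(K)\to C_{p-1}(K)$, and inner product $\langle\sigma,\tau\rangle_{C_p}=w_p(\sigma)^{-1}$ if $\sigma=\tau$ and $0$ otherwise for $\sigma,\tau\in K_p$, extended bilinearly. $\partial_p^{*}$ is the adjoint of $\partial_p$ for these inner products, and $\mathcal{L}^{\mathrm{up}}_{p-1}=\partial_p\partial_p^{*}$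 on $C_{p-1}(K)$. For a linear map $\varphi$ between finite-dimensional inner product spaces, $\varphi^{+}$ denotes the Moore–Penrose pseudoinverse: the unique linear map with $\varphi\varphi^+\varphi=\varphi$, $\varphi^+\varphi\varphi^+=\varphi^+$, and $\varphi\varphi^+$, $\varphi^+\varphi$ self-adjoint. For real matrices $A^+$ is the usual Moore–Penrose inverse (standard Euclidean inner products). The effective resistance bilinear form on $C_p(K)$ is $\mathcal{R}_p(\alpha,\alpha')=\langle \partial_p^{*}(\mathcal{L}^{\mathrm{up}}_{p-1})^{+}\partial_p\alpha,\alpha'\rangle_{C_p}$. The matrix $[\mathcal{R}_p]_{\mathcal{B}_p,\mathcal{B}_p}$ has $(i,j)$ entry $\mathcal{R}_p(\sigma_i,\sigma_j)$. *)

theory Defs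
  imports "HOL-Analysis.Finite_Function_Topology" "Jordan_Normal_Form.Matrix"
begin

subsection \<open>Adjoint and pseudoinverse of linear maps\<close>

text \<open>The chain spaces below are linear subspaces of one ambient vector space, and their inner
  products depend on weights. Adjoint and pseudoinverse are therefore taken relative to explicit
  carriers and inner products. Linear maps between carriers are extensional (undefined off the
  domain), so that they are determined by their values on the domain.\<close>

definition linear_maps :: "'v::real_vector set \<Rightarrow> 'w::real_vector set \<Rightarrow> ('v \<Rightarrow> 'w) set" where
  "linear_maps V W = {f \<in> V \<rightarrow>\<^sub>E W.
     (\<forall>x\<in>V. \<forall>y\<in>V. f (x + y) = f x + f y) \<and> (\<forall>r. \<forall>x\<in>V. f (r *\<^sub>R x) = r *\<^sub>R f x)}"

definition adjoint_on ::
  "'v::real_vector set \<Rightarrow> ('v \<Rightarrow> 'v \<Rightarrow> real) \<Rightarrow> 'w::real_vector set \<Rightarrow> ('w \<Rightarrow> 'w \<Rightarrow> real)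
    \<Rightarrow> ('v \<Rightarrow> 'w) \<Rightarrow> ('w \<Rightarrow> 'v)" where
  "adjoint_on V ipV W ipW f =
     (THE g. g \<in> linear_maps W V \<and> (\<forall>x\<in>V. \<forall>y\<in>W. ipW (f x) y = ipV x (g y)))"

definition self_adjoint_on :: "'v set \<Rightarrow> ('v \<Rightarrow> 'v \<Rightarrow> real) \<Rightarrow> ('v \<Rightarrow> 'v) \<Rightarrow> bool" where
  "self_adjoint_on V ip f \<longleftrightarrow> (\<forall>x\<in>V. \<forall>y\<in>V. ip (f x) y = ip x (f y))"

definition pinv_on ::
  "'v::real_vector set \<Rightarrow> ('v \<Rightarrow> 'v \<Rightarrow> real) \<Rightarrow> 'w::real_vector set \<Rightarrow> ('w \<Rightarrow> 'w \<Rightarrow> real)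
    \<Rightarrow> ('v \<Rightarrow> 'w) \<Rightarrow> ('w \<Rightarrow> 'v)" where
  "pinv_on V ipV W ipW f =
     (THE g. g \<in> linear_maps W V \<and>
        (\<forall>x\<in>V. f (g (f x)) = f x) \<and> (\<forall>y\<in>W. g (f (g y)) = g y) \<and>
        self_adjoint_on W ipW (f \<circ> g) \<and> self_adjoint_on V ipV (g \<circ> f))"

definition mat_pinv :: "real mat \<Rightarrow> real mat" where
  "mat_pinv A = (THE X. X \<in> carrier_mat (dim_col A) (dim_row A) \<and>
     A * X * A = A \<and> X * A * X = X \<and> (A * X)\<^sup>T = A * X \<and> (X * A)\<^sup>T = X * A)"

subsection \<open>Weighted simplicial complexes and their chains\<close>

text \<open>Simplices are nonempty finite sets of vertices. The order of the vertex type is the fixed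
  vertex ordering; a simplex is oriented by listing its vertices increasingly.\<close>

definition finite_simplicial_complex :: "'a set set \<Rightarrow> bool" where
  "finite_simplicial_complex K \<longleftrightarrow> finite K \<and> (\<forall>\<sigma>\<in>K. finite \<sigma> \<and> \<sigma> \<noteq> {}) \<and>
     (\<forall>\<sigma>\<in>K. \<forall>\<tau>. \<tau> \<subseteq> \<sigma> \<and> \<tau> \<noteq> {} \<longrightarrow> \<tau> \<in> K)"

definition p_simplices :: "'a set set \<Rightarrow> nat \<Rightarrow> 'a set set" where
  "p_simplices K p = {\<sigma>\<in>K. card \<sigma> = p + 1}"

definition weighted_complex :: "'a set set \<Rightarrow> (nat \<Rightarrow> 'a set \<Rightarrow> real) \<Rightarrow> bool" where
  "weighted_complex K w \<longleftrightarrow> finite_simplicial_complex K \<and> (\<forall>p. \<forall>\<sigma>\<in>p_simplices K p. w p \<sigma> > 0)"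

type_synonym 'a chain = "'a set \<Rightarrow>\<^sub>0 real"

definition chains :: "'a set set \<Rightarrow> nat \<Rightarrow> 'a chain set" where
  "chains K p = {c. Poly_Mapping.keys c \<subseteq> p_simplices K p}"

abbreviation basis_chain :: "'a set \<Rightarrow> 'a chain" where
  "basis_chain \<sigma> \<equiv> Poly_Mapping.single \<sigma> 1"

text \<open>Since \<^term>\<open>sorted_list_of_set \<sigma>\<close> lists the vertices increasingly from index 0, the i-th
  summand is the face of \<^term>\<open>\<sigma>\<close> omitting its i-th vertex.\<close>

definition boundary_simplex :: "nat \<Rightarrow> 'a::linorder set \<Rightarrow> 'a chain" where
  "boundary_simplex p \<sigma> = (if p = 0 then 0
     else (\<Sum>i\<le>p. (-1) ^ i *\<^sub>R basis_chain (\<sigma> - {sorted_list_of_set \<sigma> ! i})))"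

definition boundary :: "nat \<Rightarrow> 'a::linorder chain \<Rightarrow> 'a chain" where
  "boundary p c = (\<Sum>\<sigma>\<in>Poly_Mapping.keys c. Poly_Mapping.lookup c \<sigma> *\<^sub>R boundary_simplex p \<sigma>)"

definition inner_simplex :: "('a set \<Rightarrow> real) \<Rightarrow> 'a set \<Rightarrow> 'a set \<Rightarrow> real" where
  "inner_simplex v \<sigma> \<tau> = (if \<sigma> = \<tau> then inverse (v \<sigma>) else 0)"

definition inner_chain :: "('a set \<Rightarrow> real) \<Rightarrow> 'a chain \<Rightarrow> 'a chain \<Rightarrow> real" where
  "inner_chain v \<alpha> \<beta> = (\<Sum>\<sigma>\<in>Poly_Mapping.keys \<alpha>. \<Sum>\<tau>\<in>Poly_Mapping.keys \<beta>.
     Poly_Mapping.lookup \<alpha> \<sigma> * Poly_Mapping.lookup \<beta> \<tau> * inner_simplex v \<sigma> \<tau>)"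

subsection \<open>Effective resistance\<close>

definition boundary_adjoint ::
  "'a::linorder set set \<Rightarrow> (nat \<Rightarrow> 'a set \<Rightarrow> real) \<Rightarrow> nat \<Rightarrow> 'a chain \<Rightarrow> 'a chain" where
  "boundary_adjoint K w p =
     adjoint_on (chains K p) (inner_chain (w p)) (chains K (p - 1)) (inner_chain (w (p - 1)))
       (boundary p)"

definition up_laplacian ::
  "'a::linorder set set \<Rightarrow> (nat \<Rightarrow> 'a set \<Rightarrow> real) \<Rightarrow> nat \<Rightarrow> 'a chain \<Rightarrow> 'a chain" where
  "up_laplacian K w q = boundary (q + 1) \<circ> boundary_adjoint K w (q + 1)"

definition up_laplacian_pinv ::
  "'a::linorder set set \<Rightarrow> (nat \<Rightarrow> 'a set \<Rightarrow> real) \<Rightarrow> nat \<Rightarrow> 'a chain \<Rightarrow> 'a chain" where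
  "up_laplacian_pinv K w q =
     pinv_on (chains K q) (inner_chain (w q)) (chains K q) (inner_chain (w q)) (up_laplacian K w q)"

text \<open>Only meaningful for \<^term>\<open>p \<ge> (1::nat)\<close>, because of the truncated \<^term>\<open>p - (1::nat)\<close>.\<close>

definition eff_resistance ::
  "'a::linorder set set \<Rightarrow> (nat \<Rightarrow> 'a set \<Rightarrow> real) \<Rightarrow> nat \<Rightarrow> 'a chain \<Rightarrow> 'a chain \<Rightarrow> real" where
  "eff_resistance K w p \<alpha> \<alpha>' =
     inner_chain (w p) (boundary_adjoint K w p (up_laplacian_pinv K w (p - 1) (boundary p \<alpha>))) \<alpha>'"

subsection \<open>Matrices in the standard bases\<close>

text \<open>A list enumerating the simplices of one dimension fixes the indexing of the standard basis
  (from 0).\<close>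

definition enumerates :: "'b list \<Rightarrow> 'b set \<Rightarrow> bool" where
  "enumerates xs A \<longleftrightarrow> distinct xs \<and> set xs = A"

definition weight_mat :: "('a set \<Rightarrow> real) \<Rightarrow> 'a set list \<Rightarrow> real mat" where
  "weight_mat v xs = mat_diag (length xs) (\<lambda>i. v (xs ! i))"

definition linear_map_mat ::
  "('a chain \<Rightarrow> 'a chain) \<Rightarrow> 'a set list \<Rightarrow> 'a set list \<Rightarrow> real mat" where
  "linear_map_mat f ys xs = Matrix.mat (length ys) (length xs)
     (\<lambda>(i, j). Poly_Mapping.lookup (f (basis_chain (xs ! j))) (ys ! i))"

definition bilinear_form_mat ::
  "('a chain \<Rightarrow> 'a chain \<Rightarrow> real) \<Rightarrow> 'a set list \<Rightarrow> real mat" where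
  "bilinear_form_mat b xs = Matrix.mat (length xs) (length xs)
     (\<lambda>(i, j). b (basis_chain (xs ! i)) (basis_chain (xs ! j)))"

text \<open>Real power of a diagonal matrix with positive diagonal.\<close>

definition diag_mat_powr :: "real mat \<Rightarrow> real \<Rightarrow> real mat" where
  "diag_mat_powr D a = mat_diag (dim_row D) (\<lambda>i. D $$ (i, i) powr a)"

end

theory Submission
  imports Defs "Jordan_Normal_Form.Gauss_Jordan_Elimination"
begin

text \<open>The effective resistance is defined by basis-free operations, adjoint and pseudoinverse, that
  depend only on the inner products. So they may be computed in any orthonormal bases, where they
  become matrix transpose and matrix pseudoinverse. In \<^term>\<open>chains K p\<close> the vectors
  \<open>sqrt (w p \<sigma>)\<close> times \<open>\<sigma>\<close> are orthonormal, because the squared norm of \<open>\<sigma>\<close> is \<open>1 / w p \<sigma>\<close>. In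
  these bases the boundary map has the matrix \<open>N = V\<^bsup>-1/2\<^esup> B W\<^bsup>1/2\<^esup>\<close>, so that the up Laplacian has the
  matrix \<open>M = N N\<^sup>T = V\<^bsup>-1/2\<^esup> B W B\<^sup>T V\<^bsup>-1/2\<^esup>\<close> and its pseudoinverse the matrix \<open>M\<^sup>+\<close>.

  Moving the outer adjoint to the other side, \<open>R(\<alpha>, \<alpha>')\<close> is the inner product of \<open>L\<^sup>+ \<partial>\<alpha>\<close> with
  \<open>\<partial>\<alpha>'\<close>. The normalized coordinates of \<open>\<partial>\<sigma>\<^sub>i\<close> are the \<open>i\<close>-th column \<open>u\<^sub>i\<close> of \<open>V\<^bsup>-1/2\<^esup> B\<close>, so the
  \<open>(i, j)\<close> entry is \<open>M\<^sup>+ u\<^sub>i \<bullet> u\<^sub>j\<close>. As \<open>M\<close> is symmetric, so is \<open>M\<^sup>+\<close>, and this is the stated product.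
  With unit weights in dimension \<open>p - 1\<close> the factors \<open>V\<^bsup>-1/2\<^esup>\<close> are identity matrices.

  Three facts carry the argument: every real matrix has exactly one Moore-Penrose inverse
  (\<open>is_pinv_mat_pinv\<close>, \<open>is_pinv_unique\<close>); adjoint and pseudoinverse are computed in orthonormal
  coordinates (\<open>adjoint_on_eq_coord_map\<close>, \<open>pinv_on_eq_coord_map\<close>); and the matrix of the boundary
  in normalized coordinates is \<open>N\<close> (\<open>normalized_coords_boundary\<close>).\<close>

section \<open>The Moore-Penrose inverse of a real matrix\<close>

text \<open>Matching dimensions are stated as equations here, rather than by carriers, so that the
  simplifier can discharge them and use the three rules for rewriting.\<close>

lemma mult_mat_assoc:
  fixes A B C :: "'b::semiring_0 mat"
  shows "dim_col A = dim_row B \<Longrightarrow> dim_col B = dim_row C \<Longrightarrow> A * B * C = A * (B * C)"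
  by (rule assoc_mult_mat[of A "dim_row A" "dim_col A" B "dim_col B" C "dim_col C"]) auto

lemma transpose_mult_mat:
  fixes A B :: "'b::comm_semiring_0 mat"
  shows "dim_col A = dim_row B \<Longrightarrow> (A * B)\<^sup>T = B\<^sup>T * A\<^sup>T"
  by (rule transpose_mult[of A "dim_row A" "dim_col A" B "dim_col B"]) auto

lemma mult_mat_vec_assoc:
  fixes A B :: "'b::semiring_0 mat"
  shows "dim_col A = dim_row B \<Longrightarrow> dim_col B = dim_vec v \<Longrightarrow> A * B *\<^sub>v v = A *\<^sub>v (B *\<^sub>v v)"
  by (rule assoc_mult_mat_vec[of A "dim_row A" "dim_col A" B "dim_col B"]) auto

definition is_pinv :: "real mat \<Rightarrow> real mat \<Rightarrow> bool" where
  "is_pinv A X \<longleftrightarrow> X \<in> carrier_mat (dim_col A) (dim_row A) \<and>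
     A * X * A = A \<and> X * A * X = X \<and> (A * X)\<^sup>T = A * X \<and> (X * A)\<^sup>T = X * A"

text \<open>Both \<open>A X\<close> and \<open>A Y\<close> are self-adjoint idempotents with the range of \<open>A\<close>, hence equal; the same
  holds for \<open>X A\<close> and \<open>Y A\<close>. Then \<open>X = X A X = Y A Y = Y\<close>.\<close>

lemma is_pinv_unique:
  assumes X: "is_pinv A X" and Y: "is_pinv A Y"
  shows "X = Y"
proof -
  have d: "dim_row X = dim_col A" "dim_col X = dim_row A"
          "dim_row Y = dim_col A" "dim_col Y = dim_row A"
    using X Y by (auto simp: is_pinv_def)
  note x = X[unfolded is_pinv_def] and y = Y[unfolded is_pinv_def]
  have "A * X = (A * Y * A) * X" using y by simp
  also have "\<dots> = (A * Y) * (A * X)" using d by (simp add: mult_mat_assoc)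
  also have "\<dots> = ((A * X) * (A * Y))\<^sup>T" using x y d by (simp add: transpose_mult_mat[of "A * X"])
  also have "(A * X) * (A * Y) = (A * X * A) * Y" using d by (simp add: mult_mat_assoc)
  also have "(\<dots>)\<^sup>T = A * Y" using x y by simp
  finally have AX: "A * X = A * Y" .
  have "X * A = X * (A * Y * A)" using y by simp
  also have "\<dots> = (X * A) * (Y * A)" using d by (simp add: mult_mat_assoc)
  also have "\<dots> = ((Y * A) * (X * A))\<^sup>T" using x y d by (simp add: transpose_mult_mat[of "Y * A"])
  also have "(Y * A) * (X * A) = Y * (A * X * A)" using d by (simp add: mult_mat_assoc)
  also have "(\<dots>)\<^sup>T = Y * A" using x y by simp
  finally have XA: "X * A = Y * A" .
  have "X = (X * A) * X" using x by simp
  also have "\<dots> = Y * (A * X)" using d by (simp add: XA mult_mat_assoc)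
  also have "\<dots> = Y * A * Y" using d by (simp add: AX mult_mat_assoc)
  finally show ?thesis using y by simp
qed

text \<open>The diagonal entries of \<open>N\<^sup>T N\<close> are the sums of the squares of the entries in a column of \<open>N\<close>.\<close>

lemma gram_eq_0_imp:
  fixes N :: "real mat"
  assumes N: "N \<in> carrier_mat m n" and z: "N\<^sup>T * N = 0\<^sub>m n n"
  shows "N = 0\<^sub>m m n"
proof (rule eq_matI)
  fix i j assume "i < dim_row (0\<^sub>m m n :: real mat)" "j < dim_col (0\<^sub>m m n :: real mat)"
  then have ij: "i < m" "j < n" by auto
  have "(\<Sum>k<m. N $$ (k, j) * N $$ (k, j)) = (N\<^sup>T * N) $$ (j, j)"
    using N ij by (auto simp: scalar_prod_def atLeast0LessThan intro!: sum.cong)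
  also have "\<dots> = 0" using z ij by simp
  finally show "N $$ (i, j) = 0\<^sub>m m n $$ (i, j)"
    using ij by (simp add: sum_nonneg_eq_0_iff)
qed (use N in auto)

text \<open>The matrices \<open>A\<close> and \<open>A\<^sup>T A\<close> have the same kernel: if \<open>A\<^sup>T A\<close> annihilates \<open>Y - Z\<close>, then the Gram
  matrix of \<open>A (Y - Z)\<close> vanishes.\<close>

lemma gram_mult_cancel:
  fixes A :: "real mat"
  assumes A: "A \<in> carrier_mat m n" and Y: "Y \<in> carrier_mat n k" and Z: "Z \<in> carrier_mat n k"
    and eq: "A\<^sup>T * A * Y = A\<^sup>T * A * Z"
  shows "A * Y = A * Z"
proof -
  let ?N = "A * (Y - Z)"
  have YZ: "Y - Z \<in> carrier_mat n k" using Z by (rule minus_carrier_mat)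
  have P: "A\<^sup>T * A \<in> carrier_mat n n" using A by simp
  have "?N\<^sup>T * ?N = (Y - Z)\<^sup>T * (A\<^sup>T * A * (Y - Z))"
    using A Y Z by (simp add: transpose_mult_mat mult_mat_assoc)
  also have "A\<^sup>T * A * (Y - Z) = 0\<^sub>m n k"
    using mult_minus_distrib_mat[OF P Y Z] eq P Z by auto
  also have "(Y - Z)\<^sup>T * 0\<^sub>m n k = 0\<^sub>m k k"
    using YZ by (intro right_mult_zero_mat) (simp only: transpose_carrier_mat)
  finally have "?N = 0\<^sub>m m k" using gram_eq_0_imp[of ?N m k] A YZ by simp
  then have z: "A * Y - A * Z = 0\<^sub>m m k" using mult_minus_distrib_mat[OF A Y Z] by simp
  show ?thesis
  proof (rule eq_matI)
    fix i j assume "i < dim_row (A * Z)" "j < dim_col (A * Z)"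
    then have "(A * Y) $$ (i, j) - (A * Z) $$ (i, j) = (A * Y - A * Z) $$ (i, j)" "i < m" "j < k" 
      using A Z by auto
    then show "(A * Y) $$ (i, j) = (A * Z) $$ (i, j)" by (simp add: z)
  qed (use A Y Z in auto)
qed

text \<open>The pivot columns of a reduced echelon form are distinct unit vectors. Sending the \<open>i\<close>-th unit
  vector to the unit vector at the pivot position of row \<open>i\<close>, or to zero if that row has none,
  therefore inverts \<open>E\<close> on its range.\<close>

lemma row_echelon_inner_inverse:
  fixes E :: "real mat"
  assumes E: "E \<in> carrier_mat m n" and re: "row_echelon_form E"
  shows "\<exists>G\<in>carrier_mat n m. E * G * E = E"
proof -
  have d: "dim_row E = m" "dim_col E = n" using E by auto
  \<comment> \<open>A row \<open>i\<close> without pivot has \<open>f i = n\<close>, which makes column \<open>i\<close> of \<open>G\<close> below zero.\<close>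
  obtain f where "pivot_fun E f n" using re d by (auto simp: row_echelon_form_def)
  note p = pivot_funD[OF d(1) this]
  define G :: "real mat" where "G = Matrix.mat n m (\<lambda>(j, i). if f i = j then 1 else 0)"
  have EG: "(E * G) $$ (k, i) = (if f k < n \<and> i = k then 1 else 0)" if "k < m" "i < m" for k i
  proof -
    have "(E * G) $$ (k, i) = (\<Sum>j<n. E $$ (k, j) * (if f i = j then 1 else 0))"
      using that d by (simp add: G_def scalar_prod_def atLeast0LessThan)
    also have "\<dots> = (if f i < n then E $$ (k, f i) else 0)"
      by (simp add: if_distrib cong: if_cong)
    also have "\<dots> = (if f k < n \<and> i = k then 1 else 0)"
      using p(4)[of k] p(5)[of i k] that by auto
    finally show ?thesis .
  qed
  have "E * G * E = E"
  proof (rule eq_matI)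
    fix k j assume "k < dim_row E" "j < dim_col E"
    then have kj: "k < m" "j < n" using d by auto
    have "(E * G * E) $$ (k, j) = (\<Sum>i<m. (E * G) $$ (k, i) * E $$ (i, j))"
      using kj d by (simp add: G_def scalar_prod_def atLeast0LessThan)
    also have "\<dots> = (\<Sum>i<m. if i = k then (if f k < n then E $$ (i, j) else 0) else 0)"
      by (intro sum.cong refl) (simp add: EG kj del: index_mult_mat)
    also have "\<dots> = (if f k < n then E $$ (k, j) else 0)" using kj by simp
    also have "\<dots> = E $$ (k, j)" using p(1,2)[of k] kj by (cases "f k < n") auto
    finally show "(E * G * E) $$ (k, j) = E $$ (k, j)" .
  qed (use d in \<open>auto simp: G_def\<close>)
  moreover have "G \<in> carrier_mat n m" by (simp add: G_def)
  ultimately show ?thesis by blast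
qed

text \<open>Row reduction multiplies by an invertible matrix on the left, which carries an inner inverse of
  the echelon form back to one of \<open>A\<close>.\<close>

lemma inner_inverse_exists:
  fixes A :: "real mat"
  assumes A: "A \<in> carrier_mat m n"
  shows "\<exists>G\<in>carrier_mat n m. A * G * A = A"
proof -
  define E where "E = gauss_jordan_single A"
  note gj = gauss_jordan_single[OF A E_def[symmetric]]
  obtain P Q where PQ: "E = P * A" "P \<in> carrier_mat m m" "Q \<in> carrier_mat m m" "Q * P = 1\<^sub>m m"
    using gj(4) by blast
  obtain G where G: "G \<in> carrier_mat n m" "E * G * E = E"
    using row_echelon_inner_inverse[OF gj(2,3)] by blast
  have QE: "Q * E = A"
    using PQ A by (simp add: mult_mat_assoc[symmetric])
  have "A * (G * P) * A = Q * E * (G * P) * A" by (simp add: QE)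
  also have "\<dots> = Q * (E * G * (P * A))"
    using PQ(2,3) A G(1) gj(2) by (simp add: mult_mat_assoc)
  also have "\<dots> = A" by (simp add: G(2) QE flip: PQ(1))
  finally have "A * (G * P) * A = A" .
  then show ?thesis using G PQ by (intro bexI[of _ "G * P"]) auto
qed

text \<open>The witness \<open>T = (A\<^sup>T A)\<^sup>- A\<^sup>T\<close> solves the normal equations, with an arbitrary inner inverse in
  place of \<open>(A\<^sup>T A)\<^sup>-\<close>; then \<open>A T\<close> is the orthogonal projection onto the range of \<open>A\<close>.\<close>

lemma least_squares_inverse_exists:
  fixes A :: "real mat"
  assumes A: "A \<in> carrier_mat m n"
  shows "\<exists>T\<in>carrier_mat n m. A * T * A = A \<and> (A * T)\<^sup>T = A * T"
proof -
  define P where "P = A\<^sup>T * A"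
  have P: "P \<in> carrier_mat n n" "P\<^sup>T = P" using A by (auto simp: P_def transpose_mult_mat)
  obtain G where G: "G \<in> carrier_mat n n" "P * G * P = P"
    using inner_inverse_exists[OF P(1)] by blast
  have cancel: "A * (H * P) = A" if H: "H \<in> carrier_mat n n" "P * H * P = P" for H
  proof -
    have "A\<^sup>T * A * (H * P) = A\<^sup>T * A * 1\<^sub>m n"
      using H P A by (simp add: mult_mat_assoc flip: P_def)
    then have "A * (H * P) = A * 1\<^sub>m n"
      using H P by (intro gram_mult_cancel[OF A, of _ n]) auto
    then show ?thesis using A by simp
  qed
  have "(P * G * P)\<^sup>T = P * G\<^sup>T * P"
    using P G(1) by (simp add: transpose_mult_mat mult_mat_assoc)
  then have GT: "G\<^sup>T \<in> carrier_mat n n" "P * G\<^sup>T * P = P" using G P by auto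
  define T where "T = G * A\<^sup>T"
  \<comment> \<open>Although \<open>G\<close> need not be symmetric, inserting \<open>A = A G P\<close> makes \<open>A T\<close> symmetric.\<close>
  have "(A * T)\<^sup>T = (A * (G * P)) * (G\<^sup>T * A\<^sup>T)"
    using A G P cancel[OF G] by (simp add: T_def transpose_mult_mat mult_mat_assoc)
  also have "\<dots> = A * G * (A * (G * P))\<^sup>T"
    using A G P by (simp add: transpose_mult_mat mult_mat_assoc)
  also have "\<dots> = A * T" using A G cancel[OF G] by (simp add: T_def mult_mat_assoc)
  finally have "(A * T)\<^sup>T = A * T" .
  moreover have "A * T * A = A * (G * P)" using A G(1) by (simp add: T_def P_def mult_mat_assoc)
  ultimately show ?thesis using cancel[OF G] A G(1) by (intro bexI[of _ T]) (auto simp: T_def)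
qed

text \<open>Let \<open>A T\<close> be the orthogonal projection onto the range of \<open>A\<close>, and let \<open>U A\<close> be the one onto the
  orthogonal complement of its kernel, where \<open>U\<close> comes from a least squares inverse of the transpose.
  Then \<open>X = U A T\<close> satisfies \<open>A X = A T\<close> and \<open>X A = U A\<close>.\<close>

lemma is_pinv_exists: "\<exists>X. is_pinv A X"
proof -
  let ?m = "dim_row A" and ?n = "dim_col A"
  have A: "A \<in> carrier_mat ?m ?n" and AT: "A\<^sup>T \<in> carrier_mat ?n ?m" by auto
  obtain T where T: "T \<in> carrier_mat ?n ?m" "A * T * A = A" "(A * T)\<^sup>T = A * T"
    using least_squares_inverse_exists[OF A] by blast
  obtain S where S: "S \<in> carrier_mat ?m ?n" "A\<^sup>T * S * A\<^sup>T = A\<^sup>T" "(A\<^sup>T * S)\<^sup>T = A\<^sup>T * S"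
    using least_squares_inverse_exists[OF AT] by blast
  define U where "U = S\<^sup>T"
  have U: "U \<in> carrier_mat ?n ?m" using S by (simp add: U_def)
  have "(A\<^sup>T * S * A\<^sup>T)\<^sup>T = A * U * A" "(A\<^sup>T * S)\<^sup>T = U * A" 
    using S(1) by (simp_all add: U_def transpose_mult_mat mult_mat_assoc)
  then have U1: "A * U * A = A" and U2: "(U * A)\<^sup>T = U * A" using S(2,3) by auto
  let ?X = "U * A * T"
  have AX: "A * ?X = A * T" 
  proof -
    have "A * ?X = (A * U * A) * T" using U T(1) by (simp add: mult_mat_assoc)
    then show ?thesis using U1 by simp
  qed
  have XA: "?X * A = U * A" 
  proof -
    have "?X * A = U * (A * T * A)" using U T(1) by (simp add: mult_mat_assoc)
    then show ?thesis using T by simp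
  qed
  have "?X * A * ?X = U * (A * ?X)" using U T(1) by (simp only: XA) (simp add: mult_mat_assoc)
  also have "\<dots> = ?X" using U T(1) by (simp only: AX) (simp add: mult_mat_assoc)
  finally have "is_pinv A ?X" using AX XA T U U2 by (auto simp: is_pinv_def)
  then show ?thesis ..
qed

lemma is_pinv_mat_pinv: "is_pinv A (mat_pinv A)"
proof -
  obtain X where X: "is_pinv A X" using is_pinv_exists by blast
  have "mat_pinv A = (THE X. is_pinv A X)" by (simp add: mat_pinv_def is_pinv_def)
  then show ?thesis using theI[of "is_pinv A", OF X] is_pinv_unique[OF _ X] by simp
qed

text \<open>In particular the pseudoinverse of a symmetric matrix is symmetric.\<close>

lemma mat_pinv_transpose: "mat_pinv (A\<^sup>T) = (mat_pinv A)\<^sup>T"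
proof (rule is_pinv_unique[OF is_pinv_mat_pinv])
  let ?X = "mat_pinv A"
  have X: "is_pinv A ?X" by (rule is_pinv_mat_pinv)
  have d: "dim_row ?X = dim_col A" "dim_col ?X = dim_row A" using X by (auto simp: is_pinv_def)
  have "A\<^sup>T * ?X\<^sup>T * A\<^sup>T = (A * ?X * A)\<^sup>T" "?X\<^sup>T * A\<^sup>T * ?X\<^sup>T = (?X * A * ?X)\<^sup>T"
    "A\<^sup>T * ?X\<^sup>T = (?X * A)\<^sup>T" "?X\<^sup>T * A\<^sup>T = (A * ?X)\<^sup>T"
    using d by (simp_all add: transpose_mult_mat mult_mat_assoc)
  then show "is_pinv (A\<^sup>T) (?X\<^sup>T)" using X by (auto simp: is_pinv_def)
qed

section \<open>Adjoint and pseudoinverse in orthonormal coordinates\<close>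

text \<open>A linear isometry from \<open>V\<close> onto Euclidean space. Both the closure of \<open>V\<close> under the vector
  operations and the axioms of an inner product on \<open>V\<close> follow from it.\<close>

definition orthonormal_coords ::
  "'v::real_vector set \<Rightarrow> ('v \<Rightarrow> 'v \<Rightarrow> real) \<Rightarrow> nat \<Rightarrow> ('v \<Rightarrow> real vec) \<Rightarrow> bool" where
  "orthonormal_coords V ip n \<phi> \<longleftrightarrow> bij_betw \<phi> V (carrier_vec n) \<and>
     (\<forall>x\<in>V. \<forall>y\<in>V. x + y \<in> V \<and> \<phi> (x + y) = \<phi> x + \<phi> y \<and> ip x y = \<phi> x \<bullet> \<phi> y) \<and>
     (\<forall>r. \<forall>x\<in>V. r *\<^sub>R x \<in> V \<and> \<phi> (r *\<^sub>R x) = r \<cdot>\<^sub>v \<phi> x)"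

lemma orthonormal_coordsD:
  assumes "orthonormal_coords V ip n \<phi>" and "x \<in> V"
  shows "\<phi> x \<in> carrier_vec n"
    and "r *\<^sub>R x \<in> V" "\<phi> (r *\<^sub>R x) = r \<cdot>\<^sub>v \<phi> x"
    and "y \<in> V \<Longrightarrow> x + y \<in> V" "y \<in> V \<Longrightarrow> \<phi> (x + y) = \<phi> x + \<phi> y"
    and "y \<in> V \<Longrightarrow> ip x y = \<phi> x \<bullet> \<phi> y"
    and "y \<in> V \<Longrightarrow> \<phi> x = \<phi> y \<Longrightarrow> x = y"
  using assms unfolding orthonormal_coords_def bij_betw_def inj_on_def by auto

lemma orthonormal_coords_nondegenerate:
  assumes o: "orthonormal_coords V ip n \<phi>" and x: "x \<in> V" "x' \<in> V"
    and eq: "\<And>z. z \<in> V \<Longrightarrow> ip z x = ip z x'"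
  shows "x = x'"
proof (rule orthonormal_coordsD(7)[OF o x])
  note c = orthonormal_coordsD[OF o]
  show "\<phi> x = \<phi> x'"
  proof (rule eq_vecI)
    fix i assume "i < dim_vec (\<phi> x')"
    then have i: "i < n" using c(1)[OF x(2)] by auto
    obtain z where z: "z \<in> V" "\<phi> z = unit_vec n i"
      using o unfolding orthonormal_coords_def bij_betw_def by (metis image_iff unit_vec_carrier)
    then have "unit_vec n i \<bullet> \<phi> x = unit_vec n i \<bullet> \<phi> x'"
      using eq[OF z(1)] c(6)[OF z(1)] x by simp
    then show "\<phi> x $ i = \<phi> x' $ i" using i c(1) x by simp
  qed (use c(1)[OF x(1)] c(1)[OF x(2)] in auto)
qed

text \<open>The restriction makes the map extensional, as membership in \<^term>\<open>linear_maps V W\<close> requires.\<close>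

definition coord_map ::
  "'v set \<Rightarrow> ('v \<Rightarrow> real vec) \<Rightarrow> 'w set \<Rightarrow> ('w \<Rightarrow> real vec) \<Rightarrow> real mat \<Rightarrow> 'v \<Rightarrow> 'w" where
  "coord_map V \<phi> W \<psi> A = restrict (\<lambda>x. inv_into W \<psi> (A *\<^sub>v \<phi> x)) V"

lemma coord_map:
  assumes "orthonormal_coords V ipV n \<phi>" and "orthonormal_coords W ipW m \<psi>"
    and "A \<in> carrier_mat m n" and "x \<in> V"
  shows "coord_map V \<phi> W \<psi> A x \<in> W"
    and "\<psi> (coord_map V \<phi> W \<psi> A x) = A *\<^sub>v \<phi> x"
proof -
  have "A *\<^sub>v \<phi> x \<in> \<psi> ` W"
    using assms orthonormal_coordsD(1)[OF assms(1,4)]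
    by (auto simp: orthonormal_coords_def bij_betw_def)
  then show "coord_map V \<phi> W \<psi> A x \<in> W" "\<psi> (coord_map V \<phi> W \<psi> A x) = A *\<^sub>v \<phi> x"
    using assms(4) by (auto simp: coord_map_def inv_into_into f_inv_into_f)
qed

lemma coord_map_linear:
  assumes oV: "orthonormal_coords V ipV n \<phi>" and oW: "orthonormal_coords W ipW m \<psi>"
    and A: "A \<in> carrier_mat m n"
  shows "coord_map V \<phi> W \<psi> A \<in> linear_maps V W"
proof -
  let ?g = "coord_map V \<phi> W \<psi> A"
  note g = coord_map[OF oV oW A] and v = orthonormal_coordsD[OF oV] and w = orthonormal_coordsD[OF oW]
  have "?g (x + y) = ?g x + ?g y" if "x \<in> V" "y \<in> V" for x y
    by (rule w(7)) (use that A in \<open>simp_all add: g v w mult_add_distrib_mat_vec\<close>)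
  moreover have "?g (r *\<^sub>R x) = r *\<^sub>R ?g x" if "x \<in> V" for r x
    by (rule w(7)) (use that A in \<open>simp_all add: g v w mult_mat_vec\<close>)
  moreover have "?g \<in> V \<rightarrow>\<^sub>E W" using g(1) by (auto simp: coord_map_def)
  ultimately show ?thesis by (simp add: linear_maps_def)
qed

text \<open>The map with the transposed matrix is adjoint to \<open>f\<close>. Any other adjoint agrees with it on \<open>W\<close>
  by nondegeneracy, and off \<open>W\<close> both are undefined.\<close>

lemma adjoint_on_eq_coord_map:
  assumes oV: "orthonormal_coords V ipV n \<phi>" and oW: "orthonormal_coords W ipW m \<psi>"
    and A: "A \<in> carrier_mat m n"
    and fW: "\<And>x. x \<in> V \<Longrightarrow> f x \<in> W" and f: "\<And>x. x \<in> V \<Longrightarrow> \<psi> (f x) = A *\<^sub>v \<phi> x"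
  shows "adjoint_on V ipV W ipW f = coord_map W \<psi> V \<phi> (A\<^sup>T)"
  unfolding adjoint_on_def
proof (rule the_equality)
  let ?g = "coord_map W \<psi> V \<phi> (A\<^sup>T)"
  have AT: "A\<^sup>T \<in> carrier_mat n m" using A by simp
  note g = coord_map[OF oW oV AT] and v = orthonormal_coordsD[OF oV] and w = orthonormal_coordsD[OF oW]
  have gl: "?g \<in> linear_maps W V" by (rule coord_map_linear[OF oW oV AT])
  have adj: "ipW (f x) y = ipV x (?g y)" if "x \<in> V" "y \<in> W" for x y
  proof -
    have "ipV x (?g y) = \<phi> x \<bullet> (A\<^sup>T *\<^sub>v \<psi> y)" using that by (simp add: v g)
    also have "\<dots> = (A\<^sup>T *\<^sub>v \<psi> y) \<bullet> \<phi> x"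
      using that A by (intro comm_scalar_prod[of _ n]) (auto simp: v w)
    also have "\<dots> = \<psi> y \<bullet> (A *\<^sub>v \<phi> x)"
      using that A by (intro transpose_vec_mult_scalar) (auto simp: v w)
    also have "\<dots> = (A *\<^sub>v \<phi> x) \<bullet> \<psi> y"
      using that A by (intro comm_scalar_prod[of _ m]) (auto simp: v w)
    finally show ?thesis using that by (simp add: w fW f)
  qed
  show "?g \<in> linear_maps W V \<and> (\<forall>x\<in>V. \<forall>y\<in>W. ipW (f x) y = ipV x (?g y))"
    using gl adj by blast
  fix h assume h: "h \<in> linear_maps W V \<and> (\<forall>x\<in>V. \<forall>y\<in>W. ipW (f x) y = ipV x (h y))"
  show "h = ?g"
  proof (rule PiE_ext)
    show h': "h \<in> W \<rightarrow>\<^sub>E V" and g': "?g \<in> W \<rightarrow>\<^sub>E V" using h gl by (auto simp: linear_maps_def)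
    fix y assume y: "y \<in> W"
    then show "h y = ?g y"
      using h adj h' g' by (intro orthonormal_coords_nondegenerate[OF oV]) auto
  qed
qed

text \<open>The uniqueness argument for matrices again, with transposition replaced by moving a composite
  across the form and equality of values tested by nondegeneracy.\<close>

lemma generalized_inverse_unique:
  assumes f: "\<And>x. x \<in> V \<Longrightarrow> f x \<in> W"
    and g: "\<And>y. y \<in> W \<Longrightarrow> g y \<in> V" and h: "\<And>y. y \<in> W \<Longrightarrow> h y \<in> V"
    and ndV: "\<And>x x'. x \<in> V \<Longrightarrow> x' \<in> V \<Longrightarrow> (\<And>z. z \<in> V \<Longrightarrow> ipV z x = ipV z x') \<Longrightarrow> x = x'"
    and ndW: "\<And>y y'. y \<in> W \<Longrightarrow> y' \<in> W \<Longrightarrow> (\<And>z. z \<in> W \<Longrightarrow> ipW z y = ipW z y') \<Longrightarrow> y = y'"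
    and fgf: "\<And>x. x \<in> V \<Longrightarrow> f (g (f x)) = f x" and gfg: "\<And>y. y \<in> W \<Longrightarrow> g (f (g y)) = g y"
    and fhf: "\<And>x. x \<in> V \<Longrightarrow> f (h (f x)) = f x" and hfh: "\<And>y. y \<in> W \<Longrightarrow> h (f (h y)) = h y"
    and fg: "self_adjoint_on W ipW (f \<circ> g)" and gf: "self_adjoint_on V ipV (g \<circ> f)"
    and fh: "self_adjoint_on W ipW (f \<circ> h)" and hf: "self_adjoint_on V ipV (h \<circ> f)"
    and y: "y \<in> W"
  shows "g y = h y"
proof -
  note sa = fg fh gf hf
  note sa = sa[unfolded self_adjoint_on_def o_def, rule_format]
  have FG: "f (g y) = f (h y)" if y: "y \<in> W" for y
  proof (rule ndW)
    fix z assume z: "z \<in> W"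
    have "ipW z (f (g y)) = ipW z (f (h (f (g y))))" using y g by (simp add: fhf)
    also have "\<dots> = ipW (f (g (f (h z)))) y" using y z f g h by (simp flip: sa(1,2))
    also have "\<dots> = ipW z (f (h y))" using y z f g h by (simp add: fgf sa(2))
    finally show "ipW z (f (g y)) = ipW z (f (h y))" .
  qed (use y f g h in auto)
  have GF: "g (f x) = h (f x)" if x: "x \<in> V" for x
  proof (rule ndV)
    fix z assume z: "z \<in> V"
    have "ipV z (g (f x)) = ipV z (g (f (h (f x))))" using x by (simp add: fhf)
    also have "\<dots> = ipV (h (f (g (f z)))) x" using x z f g h by (simp flip: sa(3,4))
    also have "\<dots> = ipV z (h (f x))" using x z f g h by (simp add: fgf sa(4))
    finally show "ipV z (g (f x)) = ipV z (h (f x))" .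
  qed (use x f g h in auto)
  have "g y = g (f (h y))" using gfg[OF y] FG[OF y] by simp
  also have "\<dots> = h y" using GF[OF h[OF y]] hfh[OF y] by simp
  finally show ?thesis .
qed

lemma self_adjoint_on_coords:
  assumes oV: "orthonormal_coords V ip n \<phi>" and S: "S \<in> carrier_mat n n" "S\<^sup>T = S"
    and fV: "\<And>x. x \<in> V \<Longrightarrow> f x \<in> V" and f: "\<And>x. x \<in> V \<Longrightarrow> \<phi> (f x) = S *\<^sub>v \<phi> x"
  shows "self_adjoint_on V ip f"
  unfolding self_adjoint_on_def
proof (intro ballI)
  note v = orthonormal_coordsD[OF oV]
  fix x y assume xy: "x \<in> V" "y \<in> V"
  have "(S\<^sup>T *\<^sub>v \<phi> x) \<bullet> \<phi> y = \<phi> x \<bullet> (S *\<^sub>v \<phi> y)"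
    using xy S(1) by (intro transpose_vec_mult_scalar) (auto simp: v)
  then show "ip (f x) y = ip x (f y)" using xy S(2) by (simp add: v fV f)
qed

text \<open>Coordinates turn each equation between maps into the matrix equation that defines the
  Moore-Penrose inverse; self-adjointness becomes symmetry because the coordinates are isometric.\<close>

lemma pinv_on_eq_coord_map:
  assumes oV: "orthonormal_coords V ipV n \<phi>" and oW: "orthonormal_coords W ipW m \<psi>"
    and A: "A \<in> carrier_mat m n"
    and fW: "\<And>x. x \<in> V \<Longrightarrow> f x \<in> W" and f: "\<And>x. x \<in> V \<Longrightarrow> \<psi> (f x) = A *\<^sub>v \<phi> x"
  shows "pinv_on V ipV W ipW f = coord_map W \<psi> V \<phi> (mat_pinv A)"
  unfolding pinv_on_def
proof (rule the_equality)
  let ?X = "mat_pinv A" and ?g = "coord_map W \<psi> V \<phi> (mat_pinv A)"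
  have X: "?X \<in> carrier_mat n m"
    and pen: "A * ?X * A = A" "?X * A * ?X = ?X" "(A * ?X)\<^sup>T = A * ?X" "(?X * A)\<^sup>T = ?X * A"
    using is_pinv_mat_pinv[of A] A by (auto simp: is_pinv_def)
  note v = orthonormal_coordsD[OF oV] and w = orthonormal_coordsD[OF oW]
  note g = coord_map[OF oW oV X]
  have gl: "?g \<in> linear_maps W V" by (rule coord_map_linear[OF oW oV X])
  have fgf: "f (?g (f x)) = f x" if "x \<in> V" for x
  proof (rule w(7))
    have "\<psi> (f (?g (f x))) = A * ?X * A *\<^sub>v \<phi> x"
      using that A X v(1)[OF that] by (simp add: g fW f mult_mat_vec_assoc)
    then show "\<psi> (f (?g (f x))) = \<psi> (f x)" using that by (simp add: pen f)
  qed (use that in \<open>auto simp: g fW\<close>)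
  have gfg: "?g (f (?g y)) = ?g y" if "y \<in> W" for y
  proof (rule v(7))
    have "\<phi> (?g (f (?g y))) = ?X * A * ?X *\<^sub>v \<psi> y"
      using that A X w(1)[OF that] by (simp add: g fW f mult_mat_vec_assoc)
    then show "\<phi> (?g (f (?g y))) = \<phi> (?g y)" using that by (simp add: pen g)
  qed (use that in \<open>auto simp: g fW\<close>)
  have sW: "self_adjoint_on W ipW (f \<circ> ?g)"
    by (rule self_adjoint_on_coords[OF oW, of "A * ?X"])
       (use A X w(1) in \<open>auto simp: g f fW pen\<close>)
  have sV: "self_adjoint_on V ipV (?g \<circ> f)"
    by (rule self_adjoint_on_coords[OF oV, of "?X * A"])
       (use A X v(1) in \<open>auto simp: g f fW pen\<close>)
  show "?g \<in> linear_maps W V \<and>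
        (\<forall>x\<in>V. f (?g (f x)) = f x) \<and> (\<forall>y\<in>W. ?g (f (?g y)) = ?g y) \<and>
        self_adjoint_on W ipW (f \<circ> ?g) \<and> self_adjoint_on V ipV (?g \<circ> f)"
    using gl fgf gfg sW sV by blast
  fix h assume h: "h \<in> linear_maps W V \<and>
        (\<forall>x\<in>V. f (h (f x)) = f x) \<and> (\<forall>y\<in>W. h (f (h y)) = h y) \<and>
        self_adjoint_on W ipW (f \<circ> h) \<and> self_adjoint_on V ipV (h \<circ> f)"
  show "h = ?g"
  proof (rule PiE_ext)
    show h': "h \<in> W \<rightarrow>\<^sub>E V" and "?g \<in> W \<rightarrow>\<^sub>E V" using h gl by (auto simp: linear_maps_def)
    fix y assume y: "y \<in> W"
    show "h y = ?g y"
    proof (rule generalized_inverse_unique[of V f W h ?g ipV ipW])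
      show "x = x'" if "x \<in> V" "x' \<in> V" "\<And>z. z \<in> V \<Longrightarrow> ipV z x = ipV z x'" for x x'
        using orthonormal_coords_nondegenerate[OF oV that] .
      show "x = x'" if "x \<in> W" "x' \<in> W" "\<And>z. z \<in> W \<Longrightarrow> ipW z x = ipW z x'" for x x'
        using orthonormal_coords_nondegenerate[OF oW that] .
    qed (use h h' y g(1) fW fgf gfg sW sV in auto)
  qed
qed

section \<open>Chains in normalized coordinates\<close>

lemma lookup_scaleR: "Poly_Mapping.lookup (r *\<^sub>R c) k = r *\<^sub>R Poly_Mapping.lookup c k"
proof -
  have "finite {k. r *\<^sub>R Poly_Mapping.lookup c k \<noteq> 0}"
    by (rule finite_subset[OF _ finite_keys[of c]]) (auto simp: in_keys_iff)
  then show ?thesis by (simp add: scaleR_poly_mapping_def)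
qed

lemma nth_enumerates: "enumerates xs S \<Longrightarrow> i < length xs \<Longrightarrow> xs ! i \<in> S"
  using nth_mem[of i xs] by (simp add: enumerates_def)

lemma sum_enumerates:
  assumes "enumerates xs S"
  shows "(\<Sum>i<length xs. g (xs ! i)) = (\<Sum>\<sigma>\<in>S. g \<sigma>)"
  using assms sum.reindex_bij_betw[OF bij_betw_nth[of xs "{..<length xs}" S], of g]
  by (simp add: enumerates_def)

lemma inner_chain_eq_sum:
  assumes fin: "finite S" and a: "Poly_Mapping.keys a \<subseteq> S" and b: "Poly_Mapping.keys b \<subseteq> S"
  shows "inner_chain v a b = (\<Sum>\<sigma>\<in>S. Poly_Mapping.lookup a \<sigma> * Poly_Mapping.lookup b \<sigma> / v \<sigma>)"
proof -
  have "inner_chain v a b = (\<Sum>\<sigma>\<in>S. \<Sum>\<tau>\<in>S.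
     Poly_Mapping.lookup a \<sigma> * Poly_Mapping.lookup b \<tau> * inner_simplex v \<sigma> \<tau>)"
  proof -
    have "(\<Sum>\<tau>\<in>Poly_Mapping.keys b. Poly_Mapping.lookup a \<sigma> * Poly_Mapping.lookup b \<tau> * inner_simplex v \<sigma> \<tau>)
        = (\<Sum>\<tau>\<in>S. Poly_Mapping.lookup a \<sigma> * Poly_Mapping.lookup b \<tau> * inner_simplex v \<sigma> \<tau>)" for \<sigma>
      using b fin by (intro sum.mono_neutral_left) (auto simp: in_keys_iff)
    then have "inner_chain v a b = (\<Sum>\<sigma>\<in>Poly_Mapping.keys a. \<Sum>\<tau>\<in>S.
        Poly_Mapping.lookup a \<sigma> * Poly_Mapping.lookup b \<tau> * inner_simplex v \<sigma> \<tau>)"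
      by (simp add: inner_chain_def)
    also have "\<dots> = (\<Sum>\<sigma>\<in>S. \<Sum>\<tau>\<in>S.
        Poly_Mapping.lookup a \<sigma> * Poly_Mapping.lookup b \<tau> * inner_simplex v \<sigma> \<tau>)"
      using a fin by (intro sum.mono_neutral_left) (auto simp: in_keys_iff)
    finally show ?thesis .
  qed
  also have "\<dots> = (\<Sum>\<sigma>\<in>S. \<Sum>\<tau>\<in>S.
     if \<tau> = \<sigma> then Poly_Mapping.lookup a \<sigma> * Poly_Mapping.lookup b \<sigma> / v \<sigma> else 0)"
    by (intro sum.cong refl) (auto simp: inner_simplex_def divide_inverse)
  also have "\<dots> = (\<Sum>\<sigma>\<in>S. Poly_Mapping.lookup a \<sigma> * Poly_Mapping.lookup b \<sigma> / v \<sigma>)"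
    using fin by simp
  finally show ?thesis .
qed

text \<open>Coordinates with respect to the orthonormal basis of the chains \<open>sqrt (v \<sigma>)\<close> times \<open>\<sigma>\<close>.\<close>

definition normalized_coords :: "('a set \<Rightarrow> real) \<Rightarrow> 'a set list \<Rightarrow> 'a chain \<Rightarrow> real vec" where
  "normalized_coords v xs c =
     vec (length xs) (\<lambda>i. Poly_Mapping.lookup c (xs ! i) / sqrt (v (xs ! i)))"

lemma orthonormal_coords_chains:
  assumes xs: "enumerates xs (p_simplices K p)" and pos: "\<And>\<sigma>. \<sigma> \<in> p_simplices K p \<Longrightarrow> v \<sigma> > 0"
  shows "orthonormal_coords (chains K p) (inner_chain v) (length xs) (normalized_coords v xs)"
proof -
  let ?S = "p_simplices K p" and ?V = "chains K p" and ?\<phi> = "normalized_coords v xs"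
  have d: "distinct xs" and S: "set xs = ?S" using xs by (auto simp: enumerates_def)
  have nth: "xs ! i \<in> ?S" if "i < length xs" for i using that S nth_mem by metis
  have fin: "finite ?S" using S by (metis List.finite_set)
  have "inj_on ?\<phi> ?V"
  proof (rule inj_onI)
    fix a b assume ab: "a \<in> ?V" "b \<in> ?V" "?\<phi> a = ?\<phi> b"
    show "a = b"
    proof (rule poly_mapping_eqI)
      fix \<sigma>
      show "Poly_Mapping.lookup a \<sigma> = Poly_Mapping.lookup b \<sigma>"
      proof (cases "\<sigma> \<in> ?S")
        case True
        then obtain i where i: "i < length xs" "xs ! i = \<sigma>" using S by (metis in_set_conv_nth)
        have "?\<phi> a $ i = ?\<phi> b $ i" using ab by simp
        then show ?thesis using i pos[OF True] by (simp add: normalized_coords_def)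
      next
        case False
        then have "\<sigma> \<notin> Poly_Mapping.keys a" "\<sigma> \<notin> Poly_Mapping.keys b"
          using ab by (auto simp: chains_def)
        then show ?thesis by (simp add: in_keys_iff)
      qed
    qed
  qed
  moreover have "x \<in> ?\<phi> ` ?V" if x: "x \<in> carrier_vec (length xs)" for x
  proof
    define c where
      "c = (\<Sum>i<length xs. Poly_Mapping.single (xs ! i) (x $ i * sqrt (v (xs ! i))))"
    have "Poly_Mapping.keys c \<subseteq> (\<Union>i<length xs. {xs ! i})"
      unfolding c_def by (rule order_trans[OF keys_sum]) auto
    then show "c \<in> ?V" using nth by (auto simp: chains_def)
    have "Poly_Mapping.lookup c (xs ! k) = x $ k * sqrt (v (xs ! k))" if k: "k < length xs" for k
    proof -
      have "Poly_Mapping.lookup c (xs ! k)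
          = (\<Sum>i<length xs. if i = k then x $ i * sqrt (v (xs ! i)) else 0)"
        unfolding c_def lookup_sum using d k
        by (intro sum.cong refl) (auto simp: lookup_single when_def nth_eq_iff_index_eq)
      then show ?thesis using k by simp
    qed
    then show "x = ?\<phi> c"
      using x pos[OF nth] by (intro eq_vecI) (auto simp: normalized_coords_def less_imp_neq[symmetric])
  qed
  moreover have "?\<phi> ` ?V \<subseteq> carrier_vec (length xs)" by (auto simp: normalized_coords_def)
  ultimately have bij: "bij_betw ?\<phi> ?V (carrier_vec (length xs))" by (auto simp: bij_betw_def)
  have add: "a + b \<in> ?V" "?\<phi> (a + b) = ?\<phi> a + ?\<phi> b" if "a \<in> ?V" "b \<in> ?V" for a b
    using that keys_add[of a b]
    by (auto simp: chains_def normalized_coords_def lookup_add add_divide_distrib intro!: eq_vecI)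
  have ip: "inner_chain v a b = ?\<phi> a \<bullet> ?\<phi> b" if "a \<in> ?V" "b \<in> ?V" for a b
  proof -
    have "?\<phi> a \<bullet> ?\<phi> b = (\<Sum>i<length xs.
        Poly_Mapping.lookup a (xs ! i) * Poly_Mapping.lookup b (xs ! i) / v (xs ! i))"
      unfolding scalar_prod_def using pos[OF nth]
      by (auto simp: normalized_coords_def atLeast0LessThan less_imp_le intro!: sum.cong)
    also have "\<dots> = inner_chain v a b"
      using that sum_enumerates[OF xs, of "\<lambda>\<sigma>. Poly_Mapping.lookup a \<sigma> * Poly_Mapping.lookup b \<sigma> / v \<sigma>"]
        inner_chain_eq_sum[OF fin, of a b v]
      by (simp add: chains_def)
    finally show ?thesis by simp
  qed
  have scale: "r *\<^sub>R a \<in> ?V" "?\<phi> (r *\<^sub>R a) = r \<cdot>\<^sub>v ?\<phi> a" if "a \<in> ?V" for r a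
    using that by (auto simp: chains_def normalized_coords_def lookup_scaleR in_keys_iff intro!: eq_vecI)
  show ?thesis
    unfolding orthonormal_coords_def by (intro conjI ballI allI bij add ip scale)
qed

text \<open>The hypothesis on \<open>p\<close> ensures that the faces are nonempty and hence belong to the complex.\<close>

lemma boundary_simplex_in_chains:
  assumes K: "finite_simplicial_complex K" and p: "p \<ge> 1" and \<sigma>: "\<sigma> \<in> p_simplices K p"
  shows "boundary_simplex p \<sigma> \<in> chains K (p - 1)"
proof -
  have fin: "finite \<sigma>" and card: "card \<sigma> = p + 1" and \<sigma>K: "\<sigma> \<in> K"
    using K \<sigma> by (auto simp: finite_simplicial_complex_def p_simplices_def)
  have face: "\<sigma> - {sorted_list_of_set \<sigma> ! i} \<in> p_simplices K (p - 1)" if "i \<le> p" for i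
  proof -
    have "sorted_list_of_set \<sigma> ! i \<in> \<sigma>"
      using that fin card nth_mem[of i "sorted_list_of_set \<sigma>"] by simp
    then have c: "card (\<sigma> - {sorted_list_of_set \<sigma> ! i}) = p" using card by simp
    then have "\<sigma> - {sorted_list_of_set \<sigma> ! i} \<noteq> {}" using p by (metis card.empty not_one_le_zero)
    then have "\<sigma> - {sorted_list_of_set \<sigma> ! i} \<in> K"
      using K \<sigma>K unfolding finite_simplicial_complex_def by (meson Diff_subset)
    then show ?thesis using c p by (simp add: p_simplices_def)
  qed
  have "Poly_Mapping.keys (boundary_simplex p \<sigma>) \<subseteq>
      (\<Union>i\<le>p. Poly_Mapping.keys ((-1) ^ i *\<^sub>R basis_chain (\<sigma> - {sorted_list_of_set \<sigma> ! i}) :: 'a chain))"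
    using p by (simp add: boundary_simplex_def keys_sum)
  also have "\<dots> \<subseteq> p_simplices K (p - 1)"
    using face by (force simp: in_keys_iff lookup_scaleR lookup_single when_def split: if_splits)
  finally show ?thesis by (simp add: chains_def)
qed

lemma boundary_basis_chain: "boundary p (basis_chain \<sigma>) = boundary_simplex p \<sigma>"
  by (simp add: boundary_def)

lemma boundary_in_chains:
  assumes "finite_simplicial_complex K" and "p \<ge> 1" and "c \<in> chains K p"
  shows "boundary p c \<in> chains K (p - 1)"
proof -
  have "Poly_Mapping.keys (boundary p c) \<subseteq> (\<Union>\<sigma>\<in>Poly_Mapping.keys c.
      Poly_Mapping.keys (Poly_Mapping.lookup c \<sigma> *\<^sub>R boundary_simplex p \<sigma>))"
    unfolding boundary_def by (rule keys_sum)
  also have "\<dots> \<subseteq> (\<Union>\<sigma>\<in>Poly_Mapping.keys c. Poly_Mapping.keys (boundary_simplex p \<sigma>))"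
    by (auto simp: in_keys_iff lookup_scaleR)
  also have "\<dots> \<subseteq> p_simplices K (p - 1)"
    using boundary_simplex_in_chains[OF assms(1,2)] assms(3) by (fastforce simp: chains_def)
  finally show ?thesis by (simp add: chains_def)
qed

text \<open>The \<open>j\<close>-th orthonormal basis vector is \<open>sqrt (w (xs ! j))\<close> times \<open>xs ! j\<close>, which scales column \<open>j\<close>
  of the matrix of the boundary by this factor; reading the result in the orthonormal basis of the
  target divides row \<open>i\<close> by \<open>sqrt (v (ys ! i))\<close>.\<close>

lemma normalized_coords_boundary:
  assumes xs: "enumerates xs (p_simplices K p)" and pos: "\<And>\<sigma>. \<sigma> \<in> p_simplices K p \<Longrightarrow> w \<sigma> > 0"
    and c: "c \<in> chains K p"
  shows "normalized_coords v ys (boundary p c) =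
    Matrix.mat (length ys) (length xs) (\<lambda>(i, j).
       linear_map_mat (boundary p) ys xs $$ (i, j) * sqrt (w (xs ! j)) / sqrt (v (ys ! i)))
    *\<^sub>v normalized_coords w xs c" (is "_ = ?N *\<^sub>v _")
proof (rule eq_vecI)
  have S: "set xs = p_simplices K p" using xs by (simp add: enumerates_def)
  have nth: "w (xs ! j) > 0" if "j < length xs" for j using that S nth_mem pos by metis
  have fin: "finite (p_simplices K p)" using S by (metis List.finite_set)
  fix i assume "i < dim_vec (?N *\<^sub>v normalized_coords w xs c)"
  then have i: "i < length ys" by simp
  have "Poly_Mapping.lookup (boundary p c) (ys ! i) = (\<Sum>\<sigma>\<in>Poly_Mapping.keys c.
      Poly_Mapping.lookup c \<sigma> * Poly_Mapping.lookup (boundary_simplex p \<sigma>) (ys ! i))"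
    by (simp add: boundary_def lookup_sum lookup_scaleR)
  also have "\<dots> = (\<Sum>\<sigma>\<in>p_simplices K p.
      Poly_Mapping.lookup c \<sigma> * Poly_Mapping.lookup (boundary_simplex p \<sigma>) (ys ! i))"
    using c fin by (intro sum.mono_neutral_left) (auto simp: chains_def in_keys_iff)
  also have "\<dots> = (\<Sum>j<length xs.
      Poly_Mapping.lookup c (xs ! j) * Poly_Mapping.lookup (boundary_simplex p (xs ! j)) (ys ! i))"
    by (rule sum_enumerates[OF xs, symmetric])
  finally have "normalized_coords v ys (boundary p c) $ i = (\<Sum>j<length xs.
      Poly_Mapping.lookup c (xs ! j) * Poly_Mapping.lookup (boundary_simplex p (xs ! j)) (ys ! i)
        / sqrt (v (ys ! i)))"
    using i by (simp add: normalized_coords_def sum_divide_distrib)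
  also have "\<dots> = (\<Sum>j<length xs. ?N $$ (i, j) * normalized_coords w xs c $ j)"
    using i nth
    by (intro sum.cong refl)
       (auto simp: linear_map_mat_def normalized_coords_def boundary_basis_chain less_imp_neq[symmetric])
  also have "\<dots> = (?N *\<^sub>v normalized_coords w xs c) $ i"
    using i by (simp add: scalar_prod_def atLeast0LessThan normalized_coords_def)
  finally show "normalized_coords v ys (boundary p c) $ i = (?N *\<^sub>v normalized_coords w xs c) $ i" .
qed (simp add: normalized_coords_def)

section \<open>The matrix of the effective resistance form\<close>

lemma transpose_mat_diag: "(mat_diag n g)\<^sup>T = mat_diag n g"
  by (auto simp: mat_diag_def)

theorem proposition6p9:
  fixes K :: "'a::linorder set set"
    and w :: "nat \<Rightarrow> 'a set \<Rightarrow> real"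
    and p :: nat
    and ys xs :: "'a set list"
  assumes "weighted_complex K w"
    and "p \<ge> 1"
    and "enumerates ys (p_simplices K (p - 1))"
    and "enumerates xs (p_simplices K p)"
  defines "B \<equiv> linear_map_mat (boundary p) ys xs"
    and "W \<equiv> weight_mat (w p) xs"
    and "V \<equiv> weight_mat (w (p - 1)) ys"
  defines "V' \<equiv> diag_mat_powr V (- 1 / 2)"
  shows "bilinear_form_mat (eff_resistance K w p) xs
           = B\<^sup>T * V' * mat_pinv (V' * B * W * B\<^sup>T * V') * V' * B
       \<and> ((\<forall>\<sigma>\<in>p_simplices K (p - 1). w (p - 1) \<sigma> = 1) \<longrightarrow>
           bilinear_form_mat (eff_resistance K w p) xs = B\<^sup>T * mat_pinv (B * W * B\<^sup>T) * B)"
proof -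
  define q where "q = p - 1"
  then have p: "p = q + 1" using assms(2) by simp
  have K: "finite_simplicial_complex K" and pos: "\<And>q \<sigma>. \<sigma> \<in> p_simplices K q \<Longrightarrow> w q \<sigma> > 0"
    using assms(1) by (auto simp: weighted_complex_def)
  note xs = assms(4) and ys = assms(3)[folded q_def]
  note V_def = V_def[folded q_def]
  let ?m = "length ys" and ?n = "length xs"
  let ?C = "chains K p" and ?C' = "chains K q"
  let ?ip = "inner_chain (w p)" and ?ip' = "inner_chain (w q)"
  let ?\<phi> = "normalized_coords (w p) xs" and ?\<psi> = "normalized_coords (w q) ys"
  have xs_nth: "xs ! j \<in> p_simplices K p" if "j < ?n" for j
    using xs that by (rule nth_enumerates)
  have ys_nth: "ys ! i \<in> p_simplices K q" if "i < ?m" for i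
    using ys that by (rule nth_enumerates)
  have B: "B \<in> carrier_mat ?m ?n" by (simp add: B_def linear_map_mat_def)
  have V': "V' = mat_diag ?m (\<lambda>i. 1 / sqrt (w q (ys ! i)))"
    using pos[OF ys_nth]
    by (auto simp: V'_def V_def diag_mat_powr_def weight_mat_def mat_diag_def powr_minus_divide
        powr_half_sqrt less_imp_le)
  define R where "R = mat_diag ?n (\<lambda>j. sqrt (w p (xs ! j)))"
  have W: "R * R = W"
    unfolding R_def W_def weight_mat_def mat_diag_diag
    using pos[OF xs_nth] by (auto simp: mat_diag_def less_imp_le)
  have V'T: "V' \<in> carrier_mat ?m ?m" "V'\<^sup>T = V'" and RT: "R \<in> carrier_mat ?n ?n" "R\<^sup>T = R"
    by (simp_all add: V' R_def transpose_mat_diag)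
  define N where "N = V' * B * R"
  have N: "N \<in> carrier_mat ?m ?n" using V'T RT B by (simp add: N_def)
  have N_eq: "N = Matrix.mat ?m ?n (\<lambda>(i, j). B $$ (i, j) * sqrt (w p (xs ! j)) / sqrt (w q (ys ! i)))"
  proof -
    have "V' * B = Matrix.mat ?m ?n (\<lambda>(i, j). 1 / sqrt (w q (ys ! i)) * B $$ (i, j))"
      unfolding V' by (rule mat_diag_mult_left[OF B])
    then show ?thesis
      unfolding N_def R_def by (subst mat_diag_mult_right[of _ ?m]) auto
  qed
  define M where "M = V' * B * W * B\<^sup>T * V'"
  have NN: "N * N\<^sup>T = M"
    using V'T RT B by (simp add: N_def M_def transpose_mult_mat mult_mat_assoc flip: W)
  have M: "M \<in> carrier_mat ?m ?m" using N by (simp flip: NN)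
  have MT: "M\<^sup>T = M" using N by (simp add: transpose_mult_mat flip: NN)
  define X where "X = mat_pinv M"
  have X: "X \<in> carrier_mat ?m ?m" using is_pinv_mat_pinv[of M] M by (simp add: is_pinv_def X_def)
  have XT: "X\<^sup>T = X" using mat_pinv_transpose[of M] MT by (simp add: X_def)
  define U where "U = V' * B"
  have U: "U \<in> carrier_mat ?m ?n" using V'T B by (simp add: U_def)
  have o: "orthonormal_coords ?C ?ip ?n ?\<phi>" by (rule orthonormal_coords_chains[OF xs pos])
  have o': "orthonormal_coords ?C' ?ip' ?m ?\<psi>" by (rule orthonormal_coords_chains[OF ys pos])
  note c = orthonormal_coordsD[OF o] and c' = orthonormal_coordsD[OF o']
  have d: "boundary p c \<in> ?C'" if "c \<in> ?C" for c
    unfolding q_def by (rule boundary_in_chains[OF K assms(2) that])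
  have dN: "?\<psi> (boundary p c) = N *\<^sub>v ?\<phi> c" if "c \<in> ?C" for c
    unfolding N_eq B_def by (rule normalized_coords_boundary[OF xs pos that])
  have adj: "boundary_adjoint K w p = coord_map ?C' ?\<psi> ?C ?\<phi> (N\<^sup>T)"
    unfolding boundary_adjoint_def q_def[symmetric] by (rule adjoint_on_eq_coord_map[OF o o' N d dN])
  have NT: "N\<^sup>T \<in> carrier_mat ?n ?m" using N by simp
  note adj_c = coord_map[OF o' o NT, folded adj]
  have L: "up_laplacian K w q = boundary p \<circ> boundary_adjoint K w p"
    using p by (simp add: up_laplacian_def)
  have L_in: "up_laplacian K w q y \<in> ?C'"
    and L_c: "?\<psi> (up_laplacian K w q y) = M *\<^sub>v ?\<psi> y" if "y \<in> ?C'" for y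
    unfolding L o_def NN[symmetric]
    using that d adj_c N c'(1)[OF that] by (simp_all add: dN mult_mat_vec_assoc)
  have pinv: "up_laplacian_pinv K w q = coord_map ?C' ?\<psi> ?C' ?\<psi> X"
    unfolding up_laplacian_pinv_def X_def by (rule pinv_on_eq_coord_map[OF o' o' M L_in L_c])
  note pinv_c = coord_map[OF o' o' X, folded pinv]
  \<comment> \<open>The outer adjoint moves to the second argument and becomes a boundary map there.\<close>
  have eff: "eff_resistance K w p \<alpha> \<beta> = (X *\<^sub>v ?\<psi> (boundary p \<alpha>)) \<bullet> ?\<psi> (boundary p \<beta>)"
    if "\<alpha> \<in> ?C" "\<beta> \<in> ?C" for \<alpha> \<beta>
  proof -
    let ?z = "up_laplacian_pinv K w q (boundary p \<alpha>)"
    have z: "?z \<in> ?C'" "?\<psi> ?z = X *\<^sub>v ?\<psi> (boundary p \<alpha>)" using pinv_c d that by auto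
    have "eff_resistance K w p \<alpha> \<beta> = (N\<^sup>T *\<^sub>v ?\<psi> ?z) \<bullet> ?\<phi> \<beta>"
      using that z adj_c by (simp add: eff_resistance_def q_def[unfolded One_nat_def, symmetric] c)
    also have "\<dots> = ?\<psi> ?z \<bullet> (N *\<^sub>v ?\<phi> \<beta>)"
      using N c(1)[OF that(2)] c'(1)[OF z(1)] by (rule transpose_vec_mult_scalar)
    finally show ?thesis using that z by (simp add: dN)
  qed
  have basis: "basis_chain (xs ! j) \<in> ?C" if "j < ?n" for j
    using xs_nth[OF that] by (simp add: chains_def)
  have colU: "?\<psi> (boundary p (basis_chain (xs ! j))) = col U j" if j: "j < ?n" for j
  proof -
    have "U = Matrix.mat ?m ?n (\<lambda>(i, j). 1 / sqrt (w q (ys ! i)) * B $$ (i, j))"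
      unfolding U_def V' by (rule mat_diag_mult_left[OF B])
    then show ?thesis
      using j by (auto simp: normalized_coords_def B_def linear_map_mat_def)
  qed
  have main: "bilinear_form_mat (eff_resistance K w p) xs = U\<^sup>T * (X * U)"
  proof (rule eq_matI)
    fix i j assume "i < dim_row (U\<^sup>T * (X * U))" "j < dim_col (U\<^sup>T * (X * U))"
    then have ij: "i < ?n" "j < ?n" using U by auto
    have u: "col U i \<in> carrier_vec ?m" "col U j \<in> carrier_vec ?m"
      using col_dim[of U] carrier_matD(1)[OF U] by simp_all
    \<comment> \<open>The form evaluates to \<open>X u\<^sub>i \<bullet> u\<^sub>j\<close>, whereas the matrix product has the entry \<open>u\<^sub>i \<bullet> X u\<^sub>j\<close>.\<close>
    have "bilinear_form_mat (eff_resistance K w p) xs $$ (i, j) = (X\<^sup>T *\<^sub>v col U i) \<bullet> col U j"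
      using ij by (simp add: bilinear_form_mat_def eff basis colU XT)
    also have "\<dots> = col U i \<bullet> (X *\<^sub>v col U j)"
      by (rule transpose_vec_mult_scalar[OF X u(2,1)])
    also have "\<dots> = (U\<^sup>T * (X * U)) $$ (i, j)"
      using ij U X by (simp add: col_mult2[of X ?m ?m U ?n])
    finally show "bilinear_form_mat (eff_resistance K w p) xs $$ (i, j) = (U\<^sup>T * (X * U)) $$ (i, j)" .
  qed (use U in \<open>auto simp: bilinear_form_mat_def\<close>)
  also have "\<dots> = B\<^sup>T * V' * X * V' * B"
    using V'T B X by (simp add: U_def transpose_mult_mat mult_mat_assoc)
  finally have R: "bilinear_form_mat (eff_resistance K w p) xs = B\<^sup>T * V' * X * V' * B" .
  show ?thesis
  proof (intro conjI impI)
    show "bilinear_form_mat (eff_resistance K w p) xs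
        = B\<^sup>T * V' * mat_pinv (V' * B * W * B\<^sup>T * V') * V' * B"
      using R by (simp only: X_def M_def)
  next
    assume "\<forall>\<sigma>\<in>p_simplices K (p - 1). w (p - 1) \<sigma> = 1"
    then have "w q (ys ! i) = 1" if "i < ?m" for i
      using ys_nth[OF that] by (simp only: q_def)
    then have 1: "V' = 1\<^sub>m ?m" by (auto simp: V' mat_diag_def)
    have "W \<in> carrier_mat ?n ?n" using RT by (simp flip: W)
    then have "M = B * W * B\<^sup>T" using B by (simp add: M_def 1)
    moreover have "B\<^sup>T * V' * X * V' * B = B\<^sup>T * X * B" using B X by (simp add: 1)
    ultimately show "bilinear_form_mat (eff_resistance K w p) xs = B\<^sup>T * mat_pinv (B * W * B\<^sup>T) * B"
      using R by (simp only: X_def)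
  qed
qed

end
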